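(* Let $(X,\rho,\mu)$ be a space of homogeneous type such that the measure $\mu$ is Borel regular. Suppose $\nu$ is another Borel regular measure on $X$ that is absolutely continuous with respect to $\mu$. For each $x\in X$ and $r>0$ let $\overline B(x,r):=\{y\in X:\rho(x,y)\le r\}$. Then the Radon–Nikodym derivative of $\nu$ with respect to $\mu$, $$D(\nu,\mu,x):=\lim_{r\to0^+}\frac{\nu(\overline B(x,r))}{\mu(\overline B(x,r))},$$ exists and is finite for $\mu$-almost every $x\in X$. Furthermore, for each $\mu$-measurable set $S\subset X$, $$\nu(S)=\int_SD(\nu,\mu,x)\,d\mu(x).$$
   Context: A quasimetric on a set $X$ is a function $\rho:X\times X\to[0,\infty)$ with $\rho(x,y)=0$ iff $x=y$, $\rho(x,y)=\rho(y,x)$, and $\rho(x,z)\le A_0\rho(x,y)+A_0\rho(y,z)$ for all $x,y,z$, with $A_0\ge1$ a constant. $B(x,r)=\{y:\rho(x,y)<r\}$ (quasiball); a set $O$ is open if each $x\in O$ has a quasiball $B(x,r)\subset O$. A measure $\mu$ is doubling if quasiballs are $\mu$-measurable and there is $A_1\ge1$ with $0<\mu(B(x,2r))\le A_1\mu(B(x,r))<\infty$ for all $x\in X$, $r>0$. A space of homogeneous type is a triple $(X,\rho,\mu)$ with $X$ nonempty, $\rho$ a quasimetric, $\mu$ doubling; $\mu$ is defined on a $\sigma$-algebra $\mathcal M$ containing all Borel sets and all quasiballs, and $\mu$-measurable means belonging to $\mathcal M$. A measure $\lambda$ is Borel regular if for all Borel sets $E\subset X$, $\lambda(E)=\sup\{\lambda(V):V\text{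 closed},V\subset E\}=\inf\{\lambda(U):U\text{ open},E\subset U\}$. For Borel regular measures $\mu,\nu$, $\nu$ is absolutely continuous with respect to $\mu$ if for all Borel sets $E\subset X$, $\mu(E)=0$ implies $\nu(E)=0$.
   Formalization: Two hypotheses are added, as the claim fails without them: ν({x}) is finite for every x in X, and every μ-measurable set S satisfies A ⊂ S ⊂ B for Borel sets A, B with μ(B∖A) = 0; ν is taken on the same σ-algebra as μ. *)

theory Defs
  imports "HOL-Analysis.Analysis"
begin

definition quasimetric_on :: "'a set \<Rightarrow> ('a \<Rightarrow> 'a \<Rightarrow> real) \<Rightarrow> bool" where
  "quasimetric_on X \<rho> \<longleftrightarrow>
     (\<forall>x\<in>X. \<forall>y\<in>X. 0 \<le> \<rho> x y \<and> (\<rho> x y = 0 \<longleftrightarrow> x = y) \<and> \<rho> x y = \<rho> y x) \<and>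
     (\<exists>A0\<ge>1. \<forall>x\<in>X. \<forall>y\<in>X. \<forall>z\<in>X. \<rho> x z \<le> A0 * \<rho> x y + A0 * \<rho> y z)"

definition quasiball :: "'a set \<Rightarrow> ('a \<Rightarrow> 'a \<Rightarrow> real) \<Rightarrow> 'a \<Rightarrow> real \<Rightarrow> 'a set" where
  "quasiball X \<rho> x r = {y\<in>X. \<rho> x y < r}"

definition quasicball :: "'a set \<Rightarrow> ('a \<Rightarrow> 'a \<Rightarrow> real) \<Rightarrow> 'a \<Rightarrow> real \<Rightarrow> 'a set" where
  "quasicball X \<rho> x r = {y\<in>X. \<rho> x y \<le> r}"

text \<open>In the topology of a quasimetric the quasiballs need be neither open nor Borel,
  and the sets \<open>quasicball\<close> need not be closed.\<close>

definition quasi_topology :: "'a set \<Rightarrow> ('a \<Rightarrow> 'a \<Rightarrow> real) \<Rightarrow> 'a topology" where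
  "quasi_topology X \<rho> =
     topology (\<lambda>U. U \<subseteq> X \<and> (\<forall>x\<in>U. \<exists>r>0. quasiball X \<rho> x r \<subseteq> U))"

lemma openin_quasi_topology:
  "openin (quasi_topology X \<rho>) U \<longleftrightarrow>
     U \<subseteq> X \<and> (\<forall>x\<in>U. \<exists>r>0. quasiball X \<rho> x r \<subseteq> U)"
proof -
  have "istopology (\<lambda>U. U \<subseteq> X \<and> (\<forall>x\<in>U. \<exists>r>0. quasiball X \<rho> x r \<subseteq> U))"
    unfolding istopology_def
  proof (intro conjI allI impI ballI)
    fix S T x
    assume S: "S \<subseteq> X \<and> (\<forall>x\<in>S. \<exists>r>0. quasiball X \<rho> x r \<subseteq> S)"
      and T: "T \<subseteq> X \<and> (\<forall>x\<in>T. \<exists>r>0. quasiball X \<rho> x r \<subseteq> T)"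
    show "S \<inter> T \<subseteq> X" using S by blast
    assume x: "x \<in> S \<inter> T"
    then obtain r s where "r > 0" "quasiball X \<rho> x r \<subseteq> S" "s > 0" "quasiball X \<rho> x s \<subseteq> T"
      using S T by blast
    then show "\<exists>r>0. quasiball X \<rho> x r \<subseteq> S \<inter> T"
      by (intro exI[of _ "min r s"]) (auto simp: quasiball_def)
  next
    fix K x
    assume K: "\<forall>S\<in>K. S \<subseteq> X \<and> (\<forall>x\<in>S. \<exists>r>0. quasiball X \<rho> x r \<subseteq> S)"
    show "\<Union>K \<subseteq> X" using K by blast
    assume "x \<in> \<Union>K"
    then show "\<exists>r>0. quasiball X \<rho> x r \<subseteq> \<Union>K"
      using K by (meson UnionE Union_upper order_trans)
  qed
  then show ?thesis
    unfolding quasi_topology_def by simp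
qed

definition quasi_borel :: "'a set \<Rightarrow> ('a \<Rightarrow> 'a \<Rightarrow> real) \<Rightarrow> 'a set set" where
  "quasi_borel X \<rho> = sigma_sets X {U. openin (quasi_topology X \<rho>) U}"

definition doubling_measure :: "'a set \<Rightarrow> ('a \<Rightarrow> 'a \<Rightarrow> real) \<Rightarrow> 'a measure \<Rightarrow> bool" where
  "doubling_measure X \<rho> M \<longleftrightarrow>
     (\<forall>x\<in>X. \<forall>r>0. quasiball X \<rho> x r \<in> sets M) \<and>
     (\<exists>A1::real. A1 \<ge> 1 \<and> (\<forall>x\<in>X. \<forall>r>0.
        0 < emeasure M (quasiball X \<rho> x (2 * r)) \<and>
        emeasure M (quasiball X \<rho> x (2 * r)) \<le> ennreal A1 * emeasure M (quasiball X \<rho> x r) \<and>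
        ennreal A1 * emeasure M (quasiball X \<rho> x r) < \<infinity>))"

definition homogeneous_type_space :: "'a set \<Rightarrow> ('a \<Rightarrow> 'a \<Rightarrow> real) \<Rightarrow> 'a measure \<Rightarrow> bool" where
  "homogeneous_type_space X \<rho> M \<longleftrightarrow>
     X \<noteq> {} \<and> quasimetric_on X \<rho> \<and>
     space M = X \<and> quasi_borel X \<rho> \<subseteq> sets M \<and> doubling_measure X \<rho> M"

definition borel_regular :: "'a set \<Rightarrow> ('a \<Rightarrow> 'a \<Rightarrow> real) \<Rightarrow> 'a measure \<Rightarrow> bool" where
  "borel_regular X \<rho> L \<longleftrightarrow>
     space L = X \<and> quasi_borel X \<rho> \<subseteq> sets L \<and>
     (\<forall>E\<in>quasi_borel X \<rho>.
        emeasure L E = (SUP V\<in>{V. closedin (quasi_topology X \<rho>) V \<and> V \<subseteq> E}. emeasure L V) \<and>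
        emeasure L E = (INF U\<in>{U. openin (quasi_topology X \<rho>) U \<and> E \<subseteq> U}. emeasure L U))"

text \<open>Unlike \<^const>\<open>absolutely_continuous\<close>, this only tests Borel sets.\<close>

definition borel_absolutely_continuous ::
    "'a set \<Rightarrow> ('a \<Rightarrow> 'a \<Rightarrow> real) \<Rightarrow> 'a measure \<Rightarrow> 'a measure \<Rightarrow> bool" where
  "borel_absolutely_continuous X \<rho> N M \<longleftrightarrow>
     (\<forall>E\<in>quasi_borel X \<rho>. emeasure M E = 0 \<longrightarrow> emeasure N E = 0)"

text \<open>A measure on a \<open>\<sigma>\<close>-algebra larger than the Borel sets is not determined by its Borel
  values, so two such measures can agree on all Borel sets and still differ. The following
  condition, automatic for the Borel \<open>\<sigma>\<close>-algebra and for its completion, says that the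
  \<open>\<sigma>\<close>-algebra of \<open>M\<close> lies between these two.\<close>

definition measurable_sets_borel_mod_null ::
    "'a set \<Rightarrow> ('a \<Rightarrow> 'a \<Rightarrow> real) \<Rightarrow> 'a measure \<Rightarrow> bool" where
  "measurable_sets_borel_mod_null X \<rho> M \<longleftrightarrow>
     (\<forall>S\<in>sets M. \<exists>A\<in>quasi_borel X \<rho>. \<exists>B\<in>quasi_borel X \<rho>.
        A \<subseteq> S \<and> S \<subseteq> B \<and> emeasure M (B - A) = 0)"

definition ball_quotient ::
    "'a set \<Rightarrow> ('a \<Rightarrow> 'a \<Rightarrow> real) \<Rightarrow> 'a measure \<Rightarrow> 'a measure \<Rightarrow> 'a \<Rightarrow> real \<Rightarrow> ennreal" where
  "ball_quotient X \<rho> N M x r =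
     emeasure N (quasicball X \<rho> x r) / emeasure M (quasicball X \<rho> x r)"

text \<open>Where the limit does not exist, the value is unspecified.\<close>

definition ball_derivative ::
    "'a set \<Rightarrow> ('a \<Rightarrow> 'a \<Rightarrow> real) \<Rightarrow> 'a measure \<Rightarrow> 'a measure \<Rightarrow> 'a \<Rightarrow> ennreal" where
  "ball_derivative X \<rho> N M x = Lim (at_right 0) (ball_quotient X \<rho> N M x)"

end

theory Submission
  imports Defs
begin

text \<open>The measure \<open>\<nu>\<close> is locally finite, because it is finite and outer regular at points, and
  the space is Lindelof, because a doubling measure leaves room for only countably many disjoint
  balls (\<open>locally_finite_cover\<close>). So both measures are \<open>\<sigma>\<close>-finite, and the abstract Radon-Nikodym
  theorem gives \<open>\<nu>\<close> a density \<open>f\<close>, finite almost everywhere. It remains to recover \<open>f\<close> from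
  quotients of balls; the integral formula and measurability then follow, since the limit agrees
  with \<open>f\<close> almost everywhere.

  The analytic core is \<open>quotient_tendsto_0\<close>: a measure dominated by a regular one has quotients
  tending to zero at almost every point of a set on which it vanishes. A Vitali covering argument
  (\<open>Vitali_weak_type\<close>) bounds the set of bad points by the measure of an open set around it, and
  regularity makes this open set small. Applied to the truncated densities \<open>f - q\<close> on the set where
  \<open>f \<le> q\<close> and \<open>q - f\<close> on the set where \<open>f \<ge> q\<close>, for all rational \<open>q\<close>, it squeezes the quotients of
  \<open>\<nu>\<close> to \<open>f\<close> (\<open>ball_quotient_tendsto_density\<close>).

  Quasiballs are in general neither open nor Borel. They are used only as measurable sets and for
  covering; wherever an open set is required, it comes from regularity or from
  \<open>open_inside_ball\<close>.\<close>


section \<open>Coverings, countability and null sets\<close>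

text \<open>The greedy selection behind every covering lemma of Vitali type, freed from any metric:
  radii are mere labels. A set that meets a selected set must meet one whose label is at least
  half its own; a maximal family with this property meets every set, for otherwise a set with
  almost the largest label among the unmet ones could be added.\<close>
lemma Vitali_disjoint_subfamily:
  fixes B :: "'i \<Rightarrow> 'a set" and r :: "'i \<Rightarrow> real"
  assumes pos: "\<And>i. i \<in> E \<Longrightarrow> 0 < r i"
    and bound: "\<And>i. i \<in> E \<Longrightarrow> r i \<le> R"
    and ne: "\<And>i. i \<in> E \<Longrightarrow> B i \<noteq> {}"
  shows "\<exists>F. F \<subseteq> E \<and> disjoint_family_on B F \<and>
    (\<forall>i\<in>E. \<exists>j\<in>F. B i \<inter> B j \<noteq> {} \<and> r i \<le> 2 * r j)"
proof -
  \<comment> \<open>Only sets meeting \<open>F\<close> are constrained, so the property passes to unions of chains.\<close>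
  define good where "good F \<longleftrightarrow> F \<subseteq> E \<and> disjoint_family_on B F \<and>
    (\<forall>i\<in>E. (\<exists>j\<in>F. B i \<inter> B j \<noteq> {}) \<longrightarrow> (\<exists>j\<in>F. B i \<inter> B j \<noteq> {} \<and> r i \<le> 2 * r j))" for F
  have "\<exists>F\<in>Collect good. \<forall>G\<in>Collect good. F \<subseteq> G \<longrightarrow> G = F"
  proof (rule subset_Zorn')
    fix \<C> assume chain: "subset.chain (Collect good) \<C>"
    then have sub: "\<C> \<subseteq> Collect good" and tot: "\<And>F G. F \<in> \<C> \<Longrightarrow> G \<in> \<C> \<Longrightarrow> F \<subseteq> G \<or> G \<subseteq> F"
      by (auto simp: subset_chain_def)
    have "disjoint_family_on B (\<Union>\<C>)"
      unfolding disjoint_family_on_def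
    proof (intro ballI impI)
      fix i j assume "i \<in> \<Union>\<C>" "j \<in> \<Union>\<C>" and ij: "i \<noteq> j"
      then obtain F G where FG: "F \<in> \<C>" "i \<in> F" "G \<in> \<C>" "j \<in> G" by blast
      with tot[of F G] obtain H where "H \<in> \<C>" "i \<in> H" "j \<in> H" by blast
      then show "B i \<inter> B j = {}"
        using sub ij unfolding good_def disjoint_family_on_def by blast
    qed
    moreover have "\<exists>j\<in>\<Union>\<C>. B i \<inter> B j \<noteq> {} \<and> r i \<le> 2 * r j"
      if i: "i \<in> E" and meets: "\<exists>j\<in>\<Union>\<C>. B i \<inter> B j \<noteq> {}" for i
    proof -
      from meets obtain F where F: "F \<in> \<C>" "\<exists>j\<in>F. B i \<inter> B j \<noteq> {}" by blast
      then have "\<exists>j\<in>F. B i \<inter> B j \<noteq> {} \<and> r i \<le> 2 * r j"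
        using sub i unfolding good_def by blast
      with F show ?thesis by blast
    qed
    ultimately show "\<Union>\<C> \<in> Collect good"
      using sub unfolding good_def by blast
  qed
  then obtain F where F: "good F" and max: "\<And>G. good G \<Longrightarrow> F \<subseteq> G \<Longrightarrow> G = F" by auto
  have meets: "\<exists>j\<in>F. B i \<inter> B j \<noteq> {}" if i: "i \<in> E" for i
  proof (rule ccontr)
    define S where "S = {i\<in>E. \<forall>j\<in>F. B i \<inter> B j = {}}"
    assume "\<not> (\<exists>j\<in>F. B i \<inter> B j \<noteq> {})"
    with i have iS: "i \<in> S" by (auto simp: S_def)
    have bdd: "bdd_above (r ` S)" using bound by (auto simp: S_def intro!: bdd_aboveI2)
    have up: "r k \<le> Sup (r ` S)" if "k \<in> S" for k
      using cSup_upper[OF imageI[OF that] bdd] .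
    have "0 < Sup (r ` S)" using up[OF iS] pos[OF i] by linarith
    then have "Sup (r ` S) / 2 < Sup (r ` S)" by simp
    then obtain m where m: "m \<in> S" "Sup (r ` S) / 2 < r m"
      using less_cSup_iff[of "r ` S" "Sup (r ` S) / 2"] iS bdd by auto
    have mE: "m \<in> E" "\<And>j. j \<in> F \<Longrightarrow> B m \<inter> B j = {}" using m by (auto simp: S_def)
    have "good (insert m F)"
      unfolding good_def
    proof (intro conjI ballI impI)
      show "insert m F \<subseteq> E" using F mE by (auto simp: good_def)
      show "disjoint_family_on B (insert m F)"
        using F mE by (fastforce simp: good_def disjoint_family_on_def)
      fix k assume k: "k \<in> E" "\<exists>j\<in>insert m F. B k \<inter> B j \<noteq> {}"
      show "\<exists>j\<in>insert m F. B k \<inter> B j \<noteq> {} \<and> r k \<le> 2 * r j"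
      proof (cases "\<exists>j\<in>F. B k \<inter> B j \<noteq> {}")
        case True
        then show ?thesis using F k(1) unfolding good_def by blast
      next
        case False
        then have "k \<in> S" using k by (auto simp: S_def)
        then have "r k \<le> 2 * r m" using up[of k] m(2) by linarith
        then show ?thesis using False k by blast
      qed
    qed
    from max[OF this] have "m \<in> F" by blast
    with mE ne show False by blast
  qed
  show ?thesis
    using F meets unfolding good_def by blast
qed

text \<open>The traces on a set of finite measure have bounded finite partial sums, and a summable
  family has only countably many nonzero terms.\<close>
lemma countable_positive_disjoint_in_finite:
  assumes A: "A \<in> sets M" "emeasure M A \<noteq> \<infinity>"
    and sets: "\<And>i. i \<in> I \<Longrightarrow> B i \<in> sets M"
    and disj: "disjoint_family_on B I"
  shows "countable {i\<in>I. emeasure M (B i \<inter> A) \<noteq> 0}"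
proof -
  have fm: "A \<in> fmeasurable M"
    using A by (auto simp: fmeasurable_def top.not_eq_extremum)
  have fmB: "B i \<inter> A \<in> fmeasurable M" if "i \<in> I" for i
    using fmeasurable_Int_fmeasurable[OF fm sets[OF that]] by (simp add: Int_commute)
  have "(\<lambda>i. measure M (B i \<inter> A)) summable_on I"
  proof (rule nonneg_bdd_above_summable_on)
    show "bdd_above (sum (\<lambda>i. measure M (B i \<inter> A)) ` {F. F \<subseteq> I \<and> finite F})"
    proof (rule bdd_aboveI2)
      fix F assume "F \<in> {F. F \<subseteq> I \<and> finite F}"
      then have F: "F \<subseteq> I" "finite F" by auto
      have "(\<Sum>i\<in>F. measure M (B i \<inter> A)) = measure M (\<Union>i\<in>F. B i \<inter> A)"
        using F disj fmB
        by (intro measure_UNION'[symmetric])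
           (auto simp: pairwise_def disjnt_def disjoint_family_on_def)
      also have "\<dots> \<le> measure M A"
      proof (rule measure_mono_fmeasurable[OF _ _ fm])
        show "(\<Union>i\<in>F. B i \<inter> A) \<in> sets M"
          using F fmB by (intro sets.finite_UN fmeasurableD) auto
      qed auto
      finally show "(\<Sum>i\<in>F. measure M (B i \<inter> A)) \<le> measure M A" .
    qed
  qed auto
  then have "countable {i\<in>I. measure M (B i \<inter> A) \<noteq> 0}"
    by (rule summable_countable_real)
  moreover have "{i\<in>I. emeasure M (B i \<inter> A) \<noteq> 0} \<subseteq> {i\<in>I. measure M (B i \<inter> A) \<noteq> 0}"
    using fmB by (auto simp: emeasure_eq_measure2)
  ultimately show ?thesis by (rule countable_subset[rotated])
qed

lemma (in sigma_finite_measure) countable_positive_disjoint: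
  assumes sets: "\<And>i. i \<in> I \<Longrightarrow> B i \<in> sets M"
    and disj: "disjoint_family_on B I"
    and pos: "\<And>i. i \<in> I \<Longrightarrow> emeasure M (B i) \<noteq> 0"
  shows "countable I"
proof -
  obtain A :: "nat \<Rightarrow> 'a set" where A: "range A \<subseteq> sets M" "(\<Union>n. A n) = space M"
      "\<And>n. emeasure M (A n) \<noteq> \<infinity>"
    using sigma_finite by blast
  have "countable (\<Union>n. {i\<in>I. emeasure M (B i \<inter> A n) \<noteq> 0})"
    using A by (intro countable_UN countable_positive_disjoint_in_finite sets disj) auto
  moreover have "I \<subseteq> (\<Union>n. {i\<in>I. emeasure M (B i \<inter> A n) \<noteq> 0})"
  proof
    fix i assume i: "i \<in> I"
    have "\<exists>n. emeasure M (B i \<inter> A n) \<noteq> 0"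
    proof (rule ccontr)
      assume "\<nexists>n. emeasure M (B i \<inter> A n) \<noteq> 0"
      then have "emeasure M (\<Union>n. B i \<inter> A n) = 0"
        using A sets[OF i] by (intro emeasure_UN_eq_0) auto
      moreover have "(\<Union>n. B i \<inter> A n) = B i"
        using A(2) sets.sets_into_space[OF sets[OF i]] by auto
      ultimately show False using pos[OF i] by simp
    qed
    with i show "i \<in> (\<Union>n. {i\<in>I. emeasure M (B i \<inter> A n) \<noteq> 0})" by blast
  qed
  ultimately show ?thesis by (rule countable_subset[rotated])
qed

lemma emeasure_UN_countable_le:
  assumes sets[measurable]: "\<And>i. i \<in> I \<Longrightarrow> B i \<in> sets M" and I[simp]: "countable I"
  shows "emeasure M (\<Union>i\<in>I. B i) \<le> (\<integral>\<^sup>+i. emeasure M (B i) \<partial>count_space I)"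
proof -
  note sets.countable_UN'[unfolded subset_eq, measurable]
  have "emeasure M (\<Union>i\<in>I. B i) = (\<integral>\<^sup>+x. indicator (\<Union>i\<in>I. B i) x \<partial>M)"
    by simp
  also have "\<dots> \<le> (\<integral>\<^sup>+x. \<integral>\<^sup>+i. indicator (B i) x \<partial>count_space I \<partial>M)"
  proof (rule nn_integral_mono)
    fix x
    show "(indicator (\<Union>i\<in>I. B i) x :: ennreal) \<le> (\<integral>\<^sup>+i. indicator (B i) x \<partial>count_space I)"
    proof (cases "x \<in> (\<Union>i\<in>I. B i)")
      case True
      then obtain i where i: "i \<in> I" "x \<in> B i" by blast
      show ?thesis
        using nn_integral_ge_point[OF i(1), of "\<lambda>i. indicator (B i) x"] i(2) True by simp
    qed simp
  qed
  also have "\<dots> = (\<integral>\<^sup>+i. \<integral>\<^sup>+x. indicator (B i) x \<partial>M \<partial>count_space I)"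
    by (simp add: nn_integral_count_space_nn_integral)
  also have "\<dots> = (\<integral>\<^sup>+i. emeasure M (B i) \<partial>count_space I)"
    by (simp cong: nn_integral_cong_simp)
  finally show ?thesis .
qed

text \<open>Exceptional sets of differentiation theorems come without any measurability; measurable
  supersets of arbitrarily small measure replace outer measure.\<close>
lemma AE_notin_of_small_cover:
  assumes small: "\<And>e::real. 0 < e \<Longrightarrow> \<exists>W\<in>sets M. E \<subseteq> W \<and> emeasure M W \<le> ennreal e"
  shows "AE x in M. x \<notin> E"
proof -
  have "\<exists>W\<in>sets M. E \<subseteq> W \<and> emeasure M W \<le> ennreal (inverse (Suc m))" for m :: nat
    by (rule small) simp
  then obtain W where W: "\<And>m. W m \<in> sets M" "\<And>m. E \<subseteq> W m"
     "\<And>m::nat. emeasure M (W m) \<le> ennreal (inverse (Suc m))"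
    by metis
  have "(\<Inter>m. W m) \<in> null_sets M"
  proof (rule null_setsI)
    have "emeasure M (\<Inter>m. W m) \<le> ennreal (inverse (Suc m))" for m
      using W(1) by (intro order_trans[OF emeasure_mono W(3)[of m]]) auto
    moreover have "(\<lambda>m. ennreal (inverse (Suc m))) \<longlonglongrightarrow> ennreal 0"
      by (intro tendsto_ennrealI LIMSEQ_inverse_real_of_nat)
    ultimately have "emeasure M (\<Inter>m. W m) \<le> ennreal 0"
      by (intro LIMSEQ_le_const) auto
    then show "emeasure M (\<Inter>m. W m) = 0" by simp
  qed (use W(1) in auto)
  then show ?thesis
    by (rule AE_I') (use W(2) in blast)
qed

section \<open>Doubling quasimetric spaces\<close>

text \<open>Fixing the constants \<open>A0\<close> and \<open>A1\<close> makes the covering estimates uniform in the measure,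
  the set and the radii.\<close>
locale doubling_quasimetric =
  fixes X :: "'a set" and \<rho> :: "'a \<Rightarrow> 'a \<Rightarrow> real" and M :: "'a measure" and A0 A1 :: real
  assumes nonempty: "X \<noteq> {}"
    and nonneg: "x \<in> X \<Longrightarrow> y \<in> X \<Longrightarrow> 0 \<le> \<rho> x y"
    and zero_iff: "x \<in> X \<Longrightarrow> y \<in> X \<Longrightarrow> \<rho> x y = 0 \<longleftrightarrow> x = y"
    and sym: "x \<in> X \<Longrightarrow> y \<in> X \<Longrightarrow> \<rho> x y = \<rho> y x"
    and tri: "x \<in> X \<Longrightarrow> y \<in> X \<Longrightarrow> z \<in> X \<Longrightarrow> \<rho> x z \<le> A0 * \<rho> x y + A0 * \<rho> y z"
    and A0: "1 \<le> A0" and A1: "1 \<le> A1"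
    and space: "space M = X"
    and borel_sets: "quasi_borel X \<rho> \<subseteq> sets M"
    and ball_sets: "x \<in> X \<Longrightarrow> 0 < r \<Longrightarrow> quasiball X \<rho> x r \<in> sets M"
    and ball_pos: "x \<in> X \<Longrightarrow> 0 < r \<Longrightarrow> 0 < emeasure M (quasiball X \<rho> x r)"
    and ball_finite: "x \<in> X \<Longrightarrow> 0 < r \<Longrightarrow> emeasure M (quasiball X \<rho> x r) < \<infinity>"
    and doubling: "x \<in> X \<Longrightarrow> 0 < r \<Longrightarrow>
      emeasure M (quasiball X \<rho> x (2 * r)) \<le> ennreal A1 * emeasure M (quasiball X \<rho> x r)"
begin

lemma in_ball: "y \<in> quasiball X \<rho> x r \<longleftrightarrow> y \<in> X \<and> \<rho> x y < r"
  by (simp add: quasiball_def)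

lemma in_cball: "y \<in> quasicball X \<rho> x r \<longleftrightarrow> y \<in> X \<and> \<rho> x y \<le> r"
  by (simp add: quasicball_def)

lemma rho_self [simp]: "x \<in> X \<Longrightarrow> \<rho> x x = 0"
  using zero_iff by blast

lemma open_sets: "openin (quasi_topology X \<rho>) U \<Longrightarrow> U \<in> sets M"
  using borel_sets by (auto simp: quasi_borel_def)

lemma topspace_quasi [simp]: "topspace (quasi_topology X \<rho>) = X"
proof -
  have "openin (quasi_topology X \<rho>) X"
    unfolding openin_quasi_topology by (auto simp: quasiball_def intro!: exI[of _ 1])
  then show ?thesis
    by (meson openin_quasi_topology openin_subset openin_topspace subset_antisym)
qed

lemma open_quasi_borel: "openin (quasi_topology X \<rho>) U \<Longrightarrow> U \<in> quasi_borel X \<rho>"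
  by (auto simp: quasi_borel_def)

lemma quasi_borel_Int:
  assumes "A \<in> quasi_borel X \<rho>" "B \<in> quasi_borel X \<rho>"
  shows "A \<inter> B \<in> quasi_borel X \<rho>"
proof -
  have "quasi_borel X \<rho> = sets (sigma X {U. openin (quasi_topology X \<rho>) U})"
    unfolding quasi_borel_def by (rule sets_measure_of[symmetric]) (auto simp: openin_quasi_topology)
  then show ?thesis using assms by simp
qed

lemma cball_sets:
  assumes x: "x \<in> X" and r: "0 < r"
  shows "quasicball X \<rho> x r \<in> sets M"
proof -
  have "quasicball X \<rho> x r = (\<Inter>n::nat. quasiball X \<rho> x (r + inverse (Suc n)))"
  proof (intro equalityI subsetI)
    fix y assume "y \<in> (\<Inter>n::nat. quasiball X \<rho> x (r + inverse (Suc n)))"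
    then have y: "y \<in> X" "\<And>n::nat. \<rho> x y < r + inverse (Suc n)" by (auto simp: in_ball)
    have "\<not> r < \<rho> x y"
    proof
      assume "r < \<rho> x y"
      then obtain n :: nat where "inverse (Suc n) < \<rho> x y - r"
        using reals_Archimedean[of "\<rho> x y - r"] by auto
      then show False using y(2)[of n] by linarith
    qed
    then show "y \<in> quasicball X \<rho> x r" using y by (simp add: in_cball)
  qed (auto simp: in_ball in_cball intro: le_less_trans)
  also have "\<dots> \<in> sets M"
  proof (rule sets.countable_INT)
    show "range (\<lambda>n::nat. quasiball X \<rho> x (r + inverse (Suc n))) \<subseteq> sets M"
      using x r by (auto intro!: ball_sets add_pos_pos simp del: of_nat_Suc)
  qed simp
  finally show ?thesis .
qed

lemma ball_subset_cball: "quasiball X \<rho> x r \<subseteq> quasicball X \<rho> x r"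
  by (auto simp: in_ball in_cball)

lemma cball_pos: "x \<in> X \<Longrightarrow> 0 < r \<Longrightarrow> 0 < emeasure M (quasicball X \<rho> x r)"
  using ball_pos[of x r] emeasure_mono[OF ball_subset_cball cball_sets, of x r] by (meson order_less_le_trans)

lemma cball_finite:
  assumes "x \<in> X" "0 < r" shows "emeasure M (quasicball X \<rho> x r) < \<infinity>"
proof -
  have "quasicball X \<rho> x r \<subseteq> quasiball X \<rho> x (2 * r)"
    using assms by (auto simp: in_ball in_cball)
  then have "emeasure M (quasicball X \<rho> x r) \<le> emeasure M (quasiball X \<rho> x (2 * r))"
    using assms by (intro emeasure_mono ball_sets) auto
  also have "\<dots> < \<infinity>" using assms by (intro ball_finite) auto
  finally show ?thesis .
qed

text \<open>Quasiballs need not be open, so open neighbourhoods inside them have to be produced. The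
  points around which some quasiball stays inside form an open set: if the ball of radius \<open>s\<close>
  about \<open>y\<close> stays inside, so does the ball of radius \<open>s / (2 * A0)\<close> about each point at distance
  less than \<open>s / (2 * A0)\<close> from \<open>y\<close>.\<close>
lemma open_inside_ball:
  assumes x: "x \<in> X" and r: "0 < r"
  shows "\<exists>U. openin (quasi_topology X \<rho>) U \<and> x \<in> U \<and> U \<subseteq> quasiball X \<rho> x r"
proof (intro exI conjI)
  let ?U = "{y\<in>X. \<exists>s>0. quasiball X \<rho> y s \<subseteq> quasiball X \<rho> x r}"
  show "openin (quasi_topology X \<rho>) ?U"
    unfolding openin_quasi_topology
  proof (intro conjI ballI)
    show "?U \<subseteq> X" by auto
    fix y assume "y \<in> ?U"
    then obtain s where s: "y \<in> X" "0 < s" "quasiball X \<rho> y s \<subseteq> quasiball X \<rho> x r"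
      by auto
    have "quasiball X \<rho> z (s / (2 * A0)) \<subseteq> quasiball X \<rho> y s"
      if z: "z \<in> quasiball X \<rho> y (s / (2 * A0))" for z
    proof
      fix w assume w: "w \<in> quasiball X \<rho> z (s / (2 * A0))"
      have "\<rho> y w \<le> A0 * \<rho> y z + A0 * \<rho> z w"
        using tri s z w by (auto simp: in_ball)
      also have "\<dots> < A0 * (s / (2 * A0)) + A0 * (s / (2 * A0))"
        using z w A0 by (intro add_strict_mono mult_strict_left_mono) (auto simp: in_ball)
      also have "\<dots> = s" using A0 by (simp add: field_simps)
      finally show "w \<in> quasiball X \<rho> y s" using w by (simp add: in_ball)
    qed
    moreover have "0 < s / (2 * A0)" using s A0 by simp
    ultimately have "quasiball X \<rho> y (s / (2 * A0)) \<subseteq> ?U"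
      using s(3) by (fastforce simp: quasiball_def[of X \<rho> y])
    then show "\<exists>t>0. quasiball X \<rho> y t \<subseteq> ?U"
      using \<open>0 < s / (2 * A0)\<close> by blast
  qed
  show "x \<in> ?U" using x r by auto
  show "?U \<subseteq> quasiball X \<rho> x r"
  proof
    fix y assume "y \<in> ?U"
    then obtain s where "y \<in> X" "0 < s" "quasiball X \<rho> y s \<subseteq> quasiball X \<rho> x r"
      by auto
    moreover from this have "y \<in> quasiball X \<rho> y s" by (simp add: in_ball)
    ultimately show "y \<in> quasiball X \<rho> x r" by blast
  qed
qed

lemma sigma_finite_measure_space: "sigma_finite_measure M"
proof
  obtain x0 where x0: "x0 \<in> X" using nonempty by blast
  let ?A = "range (\<lambda>n::nat. quasiball X \<rho> x0 (Suc n))"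
  have "\<Union>?A = space M"
  proof (intro equalityI subsetI)
    fix y assume y: "y \<in> space M"
    obtain n :: nat where "\<rho> x0 y < n" using reals_Archimedean2 by blast
    then have "\<rho> x0 y < Suc n" by simp
    then show "y \<in> \<Union>?A" using y space by (auto simp: in_ball simp del: of_nat_Suc)
  qed (auto simp: in_ball space)
  moreover have "\<forall>a\<in>?A. emeasure M a \<noteq> \<infinity>"
  proof
    fix a assume "a \<in> ?A"
    then obtain n where "a = quasiball X \<rho> x0 (Suc n)" by blast
    then show "emeasure M a \<noteq> \<infinity>" using ball_finite[OF x0, of "real (Suc n)"] by simp
  qed
  moreover have "?A \<subseteq> sets M"
    using x0 by (auto intro!: ball_sets simp del: of_nat_Suc)
  ultimately show "\<exists>A. countable A \<and> A \<subseteq> sets M \<and> \<Union>A = space M \<and> (\<forall>a\<in>A. emeasure M a \<noteq> \<infinity>)"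
    by (intro exI[of _ ?A]) simp
qed

sublocale M: sigma_finite_measure M
  by (rule sigma_finite_measure_space)

text \<open>The factor \<open>4 * A0\<close> is the enlargement needed in the Vitali covering below; iterating the
  doubling inequality bounds its cost.\<close>
lemma engulfing_constant:
  obtains C :: real where "0 < C"
    "\<And>x r. x \<in> X \<Longrightarrow> 0 < r \<Longrightarrow>
       emeasure M (quasiball X \<rho> x (4 * A0 * r)) \<le> ennreal C * emeasure M (quasiball X \<rho> x r)"
proof -
  obtain k :: nat where k: "4 * A0 < 2 ^ k" using real_arch_pow[of 2 "4 * A0"] by auto
  have iter: "emeasure M (quasiball X \<rho> x (2 ^ n * r)) \<le> ennreal (A1 ^ n) * emeasure M (quasiball X \<rho> x r)"
    if "x \<in> X" "0 < r" for x r n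
  proof (induction n)
    case (Suc n)
    have "emeasure M (quasiball X \<rho> x (2 ^ Suc n * r)) \<le> ennreal A1 * emeasure M (quasiball X \<rho> x (2 ^ n * r))"
      using doubling[of x "2 ^ n * r"] that by (simp add: mult.assoc)
    also have "\<dots> \<le> ennreal A1 * (ennreal (A1 ^ n) * emeasure M (quasiball X \<rho> x r))"
      by (intro mult_left_mono Suc) auto
    also have "\<dots> = ennreal (A1 ^ Suc n) * emeasure M (quasiball X \<rho> x r)"
      using A1 by (simp add: ennreal_mult mult.assoc)
    finally show ?case .
  qed simp
  show ?thesis
  proof
    show "0 < A1 ^ k" using A1 by simp
    fix x and r :: real assume xr: "x \<in> X" "0 < r"
    have "4 * A0 * r \<le> 2 ^ k * r" using k xr by (intro mult_right_mono) auto
    then have "quasiball X \<rho> x (4 * A0 * r) \<subseteq> quasiball X \<rho> x (2 ^ k * r)"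
      by (auto simp: in_ball)
    then have "emeasure M (quasiball X \<rho> x (4 * A0 * r)) \<le> emeasure M (quasiball X \<rho> x (2 ^ k * r))"
      using xr by (intro emeasure_mono ball_sets) auto
    also have "\<dots> \<le> ennreal (A1 ^ k) * emeasure M (quasiball X \<rho> x r)"
      by (rule iter[OF xr])
    finally show "emeasure M (quasiball X \<rho> x (4 * A0 * r)) \<le> ennreal (A1 ^ k) * emeasure M (quasiball X \<rho> x r)" .
  qed
qed

text \<open>The weak type inequality. For disjoint balls selected by \<open>Vitali_disjoint_subfamily\<close>, the
  enlarged balls cover all centres, since a ball meeting a selected ball of radius at least half
  its own has its centre within \<open>3 * A0\<close> times that radius of the selected centre. Disjointness
  sums the values of \<open>L\<close>, and doubling compares the enlarged balls with the selected ones. The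
  set \<open>E\<close> of centres is arbitrary, hence the measurable superset \<open>W\<close>.\<close>
lemma Vitali_weak_type:
  fixes t C :: real
  assumes engulf: "\<And>x r. x \<in> X \<Longrightarrow> 0 < r \<Longrightarrow>
       emeasure M (quasiball X \<rho> x (4 * A0 * r)) \<le> ennreal C * emeasure M (quasiball X \<rho> x r)"
    and sets_L: "sets L = sets M" and U: "U \<in> sets M" and E: "E \<subseteq> X"
    and balls: "\<And>x. x \<in> E \<Longrightarrow> \<exists>r. 0 < r \<and> r \<le> 1 \<and> quasicball X \<rho> x r \<subseteq> U \<and>
        ennreal t * emeasure M (quasicball X \<rho> x r) \<le> emeasure L (quasicball X \<rho> x r)"
  shows "\<exists>W\<in>sets M. E \<subseteq> W \<and> ennreal t * emeasure M W \<le> ennreal C * emeasure L U"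
proof -
  obtain r where r: "\<And>x. x \<in> E \<Longrightarrow> 0 < r x" "\<And>x. x \<in> E \<Longrightarrow> r x \<le> 1"
      "\<And>x. x \<in> E \<Longrightarrow> quasicball X \<rho> x (r x) \<subseteq> U"
      "\<And>x. x \<in> E \<Longrightarrow> ennreal t * emeasure M (quasicball X \<rho> x (r x)) \<le> emeasure L (quasicball X \<rho> x (r x))"
    using balls by metis
  let ?B = "\<lambda>x. quasicball X \<rho> x (r x)"
  have EX: "x \<in> X" if "x \<in> E" for x using E that by blast
  have self: "x \<in> ?B x" if "x \<in> E" for x
    using that EX r by (auto simp: in_cball less_imp_le)
  have ne: "?B x \<noteq> {}" if "x \<in> E" for x using self[OF that] by blast
  obtain F where F: "F \<subseteq> E" "disjoint_family_on ?B F"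
      "\<forall>x\<in>E. \<exists>y\<in>F. ?B x \<inter> ?B y \<noteq> {} \<and> r x \<le> 2 * r y"
    using Vitali_disjoint_subfamily[of E r 1 ?B] r(1,2) ne by (metis (no_types, lifting))
  have FE: "y \<in> E" if "y \<in> F" for y using F that by blast
  have Bsets: "?B y \<in> sets M" if "y \<in> F" for y
    using FE[OF that] by (auto intro: cball_sets EX r)
  have cF: "countable F"
    using FE EX r(1) F(2) Bsets cball_pos
    by (intro M.countable_positive_disjoint[of F ?B]) (auto simp: less_le)
  let ?D = "\<lambda>y. quasiball X \<rho> y (4 * A0 * r y)"
  have Dsets: "?D y \<in> sets M" if "y \<in> F" for y
    using FE[OF that] A0 by (auto intro!: ball_sets EX r mult_pos_pos)
  show ?thesis
  proof (intro bexI conjI)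
    show W: "(\<Union>y\<in>F. ?D y) \<in> sets M"
      using cF Dsets by (intro sets.countable_UN') auto
    show "E \<subseteq> (\<Union>y\<in>F. ?D y)"
    proof
      fix x assume x: "x \<in> E"
      then obtain y z where y: "y \<in> F" "z \<in> ?B x" "z \<in> ?B y" "r x \<le> 2 * r y"
        using bspec[OF F(3) x] by blast
      have "\<rho> y x \<le> A0 * \<rho> y z + A0 * \<rho> z x"
        using tri y FE EX x by (auto simp: in_cball)
      also have "\<rho> z x = \<rho> x z" using sym y EX x by (auto simp: in_cball)
      also have "A0 * \<rho> y z + A0 * \<rho> x z \<le> A0 * r y + A0 * (2 * r y)"
        using y A0 by (intro add_mono mult_left_mono) (auto simp: in_cball)
      also have "\<dots> < 4 * A0 * r y"
        using A0 r(1)[OF FE[OF y(1)]] by (simp add: algebra_simps)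
      finally show "x \<in> (\<Union>y\<in>F. ?D y)" using y EX[OF x] by (auto simp: in_ball)
    qed
    have DB: "ennreal t * emeasure M (?D y) \<le> ennreal C * emeasure L (?B y)" if y: "y \<in> F" for y
    proof -
      have "emeasure M (?D y) \<le> ennreal C * emeasure M (quasiball X \<rho> y (r y))"
        using FE[OF y] by (intro engulf EX r)
      also have "\<dots> \<le> ennreal C * emeasure M (?B y)"
        by (intro mult_left_mono emeasure_mono ball_subset_cball Bsets y) auto
      finally have "ennreal t * emeasure M (?D y) \<le> ennreal t * (ennreal C * emeasure M (?B y))"
        by (rule mult_left_mono) simp
      also have "\<dots> = ennreal C * (ennreal t * emeasure M (?B y))"
        by (simp add: ac_simps)
      also have "\<dots> \<le> ennreal C * emeasure L (?B y)"
        by (intro mult_left_mono r FE y) auto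
      finally show ?thesis .
    qed
    have "ennreal t * emeasure M (\<Union>y\<in>F. ?D y) \<le> ennreal t * (\<integral>\<^sup>+y. emeasure M (?D y) \<partial>count_space F)"
      by (intro mult_left_mono emeasure_UN_countable_le Dsets cF) auto
    also have "\<dots> = (\<integral>\<^sup>+y. ennreal t * emeasure M (?D y) \<partial>count_space F)"
      by (simp add: nn_integral_cmult)
    also have "\<dots> \<le> (\<integral>\<^sup>+y. ennreal C * emeasure L (?B y) \<partial>count_space F)"
      using DB by (intro nn_integral_mono) auto
    also have "\<dots> = ennreal C * (\<integral>\<^sup>+y. emeasure L (?B y) \<partial>count_space F)"
      by (simp add: nn_integral_cmult)
    also have "(\<integral>\<^sup>+y. emeasure L (?B y) \<partial>count_space F) = emeasure L (\<Union>y\<in>F. ?B y)"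
      using Bsets sets_L cF F(2) by (intro emeasure_UN_countable[symmetric]) auto
    also have "ennreal C * \<dots> \<le> ennreal C * emeasure L U"
      using r(3) FE U sets_L by (intro mult_left_mono emeasure_mono) auto
    finally show "ennreal t * emeasure M (\<Union>y\<in>F. ?D y) \<le> ennreal C * emeasure L U" .
  qed
qed

text \<open>For each scale, a maximal disjoint family of balls of that radius is countable because its
  members have positive measure, and its centres come close to every point.\<close>
lemma countable_dense:
  obtains D where "countable D" "D \<subseteq> X"
    "\<And>x e. x \<in> X \<Longrightarrow> 0 < e \<Longrightarrow> \<exists>d\<in>D. \<rho> x d < e"
proof -
  have "\<exists>F. countable F \<and> F \<subseteq> X \<and> (\<forall>x\<in>X. \<exists>d\<in>F. \<rho> x d < 2 * A0 * s)" if s: "0 < s" for s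
  proof -
    let ?B = "\<lambda>x. quasiball X \<rho> x s"
    have self: "x \<in> ?B x" if "x \<in> X" for x using that s by (simp add: in_ball)
    have ne: "?B x \<noteq> {}" if "x \<in> X" for x using self[OF that] by blast
    obtain F where F: "F \<subseteq> X" "disjoint_family_on ?B F"
        "\<forall>x\<in>X. \<exists>y\<in>F. ?B x \<inter> ?B y \<noteq> {} \<and> s \<le> 2 * s"
      using Vitali_disjoint_subfamily[of X "\<lambda>_. s" s ?B] s ne by (metis (no_types, lifting) order_refl)
    have "countable F"
      using F ball_sets ball_pos s
      by (intro M.countable_positive_disjoint[of F ?B]) (auto simp: less_le)
    moreover have "\<exists>d\<in>F. \<rho> x d < 2 * A0 * s" if x: "x \<in> X" for x
    proof -
      obtain y z where y: "y \<in> F" "z \<in> ?B x" "z \<in> ?B y" using bspec[OF F(3) x] by blast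
      have "\<rho> x y \<le> A0 * \<rho> x z + A0 * \<rho> z y"
        using tri y F x by (auto simp: in_ball)
      also have "\<rho> z y = \<rho> y z" using sym y F by (auto simp: in_ball)
      also have "A0 * \<rho> x z + A0 * \<rho> y z < A0 * s + A0 * s"
        using y A0 by (intro add_strict_mono mult_strict_left_mono) (auto simp: in_ball)
      finally show ?thesis using y by (auto simp: algebra_simps)
    qed
    ultimately show ?thesis using F(1) by blast
  qed
  then obtain F where F: "\<And>s. 0 < s \<Longrightarrow> countable (F s)" "\<And>s. 0 < s \<Longrightarrow> F s \<subseteq> X"
      "\<And>s x. 0 < s \<Longrightarrow> x \<in> X \<Longrightarrow> \<exists>d\<in>F s. \<rho> x d < 2 * A0 * s"
    by metis
  show ?thesis
  proof
    let ?D = "\<Union>n::nat. F (inverse (Suc n))"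
    show "countable ?D" "?D \<subseteq> X"
      using F(1,2)[of "inverse (real (Suc n))" for n] by (auto simp del: of_nat_Suc)
    fix x and e :: real assume x: "x \<in> X" "0 < e"
    then obtain n :: nat where n: "inverse (Suc n) < e / (2 * A0)"
      using reals_Archimedean[of "e / (2 * A0)"] A0 by auto
    then have "2 * A0 * inverse (Suc n) < e"
      using A0 by (simp add: field_simps)
    then show "\<exists>d\<in>?D. \<rho> x d < e"
      using F(3)[of "inverse (real (Suc n))" x] x by (force simp del: of_nat_Suc)
  qed
qed

text \<open>The Lindelof property, phrased for a property \<open>P\<close> holding of some open neighbourhood of
  each point. As balls about the points of a dense set are not available as open sets, one
  suitable open set is chosen for each such ball that is contained in one.\<close>
lemma Lindelof:
  assumes P: "\<And>x. x \<in> X \<Longrightarrow> \<exists>U. openin (quasi_topology X \<rho>) U \<and> x \<in> U \<and> P U"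
  shows "\<exists>\<U>. countable \<U> \<and> \<Union>\<U> = X \<and> (\<forall>U\<in>\<U>. openin (quasi_topology X \<rho>) U \<and> P U)"
proof -
  obtain D where D: "countable D" "D \<subseteq> X"
    "\<And>x e. x \<in> X \<Longrightarrow> 0 < e \<Longrightarrow> \<exists>d\<in>D. \<rho> x d < e"
    by (fact countable_dense)
  let ?ok = "\<lambda>d n U. openin (quasi_topology X \<rho>) U \<and> P U \<and>
      quasiball X \<rho> d (inverse (real (Suc n))) \<subseteq> U"
  define I where "I = {(d, n). d \<in> D \<and> (\<exists>U. ?ok d n U)}"
  define V where "V = (\<lambda>(d, n). SOME U. ?ok d n U)"
  have V: "?ok d n (V (d, n))" if "(d, n) \<in> I" for d n
  proof -
    have "\<exists>U. ?ok d n U" using that by (auto simp: I_def)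
    then have "?ok d n (SOME U. ?ok d n U)" by (rule someI_ex)
    then show ?thesis by (simp add: V_def)
  qed
  show ?thesis
  proof (intro exI conjI ballI)
    have "I \<subseteq> D \<times> UNIV" by (auto simp: I_def)
    then have "countable I"
      by (rule countable_subset) (simp add: D)
    then show "countable (V ` I)" by simp
    show "openin (quasi_topology X \<rho>) U" "P U" if "U \<in> V ` I" for U
      using that V by auto
    show "\<Union>(V ` I) = X"
    proof (intro equalityI subsetI)
      fix x assume "x \<in> \<Union>(V ` I)"
      then obtain d n where "(d, n) \<in> I" "x \<in> V (d, n)" by auto
      then show "x \<in> X" using V[of d n] unfolding openin_quasi_topology by blast
    next
      fix x assume x: "x \<in> X"
      then obtain U where U: "openin (quasi_topology X \<rho>) U" "x \<in> U" "P U" using P by blast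
      then obtain e where e: "0 < e" "quasiball X \<rho> x e \<subseteq> U"
        unfolding openin_quasi_topology by blast
      obtain n :: nat where n: "inverse (Suc n) < e / (2 * A0)"
        using reals_Archimedean[of "e / (2 * A0)"] A0 e by auto
      obtain d where d: "d \<in> D" "\<rho> x d < inverse (Suc n)"
        using D(3)[OF x, of "inverse (Suc n)"] by auto
      then have dX: "d \<in> X" using D by blast
      have "quasiball X \<rho> d (inverse (real (Suc n))) \<subseteq> quasiball X \<rho> x e"
      proof
        fix z assume z: "z \<in> quasiball X \<rho> d (inverse (real (Suc n)))"
        have "\<rho> x z \<le> A0 * \<rho> x d + A0 * \<rho> d z"
          using tri z dX x by (auto simp: in_ball)
        also have "\<dots> < A0 * (e / (2 * A0)) + A0 * (e / (2 * A0))"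
          using z d n A0 by (intro add_strict_mono mult_strict_left_mono) (auto simp: in_ball)
        also have "\<dots> = e" using A0 by (simp add: field_simps)
        finally show "z \<in> quasiball X \<rho> x e" using z by (simp add: in_ball)
      qed
      then have "(d, n) \<in> I" using U e d unfolding I_def by blast
      moreover have "x \<in> V (d, n)"
        using V[OF \<open>(d, n) \<in> I\<close>] d x dX sym[of x d] by (auto simp: in_ball)
      ultimately show "x \<in> \<Union>(V ` I)" by blast
    qed
  qed
qed

lemma singleton_borel: assumes x: "x \<in> X" shows "{x} \<in> quasi_borel X \<rho>"
proof -
  have "openin (quasi_topology X \<rho>) (X - {x})"
    unfolding openin_quasi_topology
  proof (intro conjI ballI)
    fix y assume y: "y \<in> X - {x}"
    then have "0 < \<rho> y x" using nonneg[of y x] zero_iff[of y x] x by auto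
    then show "\<exists>r>0. quasiball X \<rho> y r \<subseteq> X - {x}"
      by (intro exI[of _ "\<rho> y x"]) (auto simp: in_ball)
  qed auto
  then have "X - (X - {x}) \<in> quasi_borel X \<rho>"
    unfolding quasi_borel_def by (intro sigma_sets.Compl sigma_sets.Basic) simp
  then show ?thesis using x by (simp add: double_diff)
qed

lemma borel_regular_outer:
  assumes reg: "borel_regular X \<rho> R" and E: "E \<in> quasi_borel X \<rho>" and less: "emeasure R E < c"
  shows "\<exists>U. openin (quasi_topology X \<rho>) U \<and> E \<subseteq> U \<and> emeasure R U < c"
proof -
  have "emeasure R E = (INF U\<in>{U. openin (quasi_topology X \<rho>) U \<and> E \<subseteq> U}. emeasure R U)"
    using reg E unfolding borel_regular_def by blast
  then show ?thesis using less by (auto simp: INF_less_iff)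
qed

section \<open>Small quotients on null sets\<close>

text \<open>Regularity is known for \<open>R\<close> only. It transfers to \<open>L\<close> near an \<open>L\<close>-null set, where only the
  excess \<open>V - A \<inter> U\<close> of the open set counts, and there \<open>L\<close> is dominated by \<open>R\<close>.\<close>
lemma open_superset_small:
  assumes sets_L: "sets L = sets M" and sets_R: "sets R = sets M"
    and reg: "borel_regular X \<rho> R"
    and le: "\<And>S. S \<in> sets M \<Longrightarrow> emeasure L S \<le> ennreal c * emeasure R S" and c: "0 \<le> c"
    and A: "A \<in> quasi_borel X \<rho>" "emeasure L A = 0"
    and U: "openin (quasi_topology X \<rho>) U" "emeasure R U < \<infinity>" and d: "0 < d"
  shows "\<exists>V. openin (quasi_topology X \<rho>) V \<and> A \<inter> U \<subseteq> V \<and> emeasure L V \<le> ennreal (c * d)"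
proof -
  have UM: "U \<in> sets M" using U(1) by (rule open_sets)
  have AM: "A \<in> sets M" using A borel_sets by blast
  have AU: "A \<inter> U \<in> quasi_borel X \<rho>"
    by (intro quasi_borel_Int A open_quasi_borel U)
  have fin: "emeasure R (A \<inter> U) < \<infinity>"
    using emeasure_mono[of "A \<inter> U" U R] UM sets_R U(2) by (auto intro: le_less_trans)
  have "emeasure R (A \<inter> U) + 0 < emeasure R (A \<inter> U) + ennreal d"
    using fin d by (subst ennreal_add_left_cancel_less) auto
  then obtain V where V: "openin (quasi_topology X \<rho>) V" "A \<inter> U \<subseteq> V"
      "emeasure R V < emeasure R (A \<inter> U) + ennreal d"
    using borel_regular_outer[OF reg AU] by (metis add.right_neutral)
  have VM: "V \<in> sets M" using V(1) by (rule open_sets)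
  have "V = (V - A \<inter> U) \<union> (A \<inter> U)" using V(2) by blast
  then have "emeasure L V \<le> emeasure L (V - A \<inter> U) + emeasure L (A \<inter> U)"
    using emeasure_subadditive[of "V - A \<inter> U" L "A \<inter> U"] VM AM UM sets_L by auto
  also have "emeasure L (A \<inter> U) = 0"
    using emeasure_mono[of "A \<inter> U" A L] A(2) AM sets_L by simp
  also have "emeasure L (V - A \<inter> U) + 0 \<le> ennreal c * emeasure R (V - A \<inter> U)"
    using VM AM UM by (simp add: le)
  also have "emeasure R (V - A \<inter> U) = emeasure R V - emeasure R (A \<inter> U)"
    using V(2) VM AM UM sets_R fin by (intro emeasure_Diff) auto
  also have "\<dots> \<le> ennreal d"
    using V(3) fin by (subst ennreal_minus_le_iff) (auto simp: less_imp_le)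
  also have "ennreal c * ennreal d = ennreal (c * d)"
    using c d by (simp add: ennreal_mult)
  finally show ?thesis using V by (auto simp: mult_left_mono)
qed

text \<open>Where \<open>L\<close> vanishes on \<open>A\<close>, its quotients cannot stay above a fixed threshold on a set of
  positive measure: such a set is covered by balls inside an open set of arbitrarily small
  \<open>L\<close>-measure, and the weak type inequality makes it small for \<open>M\<close> as well.\<close>
lemma quotient_tendsto_0:
  assumes sets_L: "sets L = sets M" and sets_R: "sets R = sets M"
    and reg: "borel_regular X \<rho> R"
    and le: "\<And>S. S \<in> sets M \<Longrightarrow> emeasure L S \<le> ennreal c * emeasure R S" and c: "0 \<le> c"
    and bmn: "measurable_sets_borel_mod_null X \<rho> M"
    and cov: "countable \<U>" "\<Union>\<U> = X" "\<And>U. U \<in> \<U> \<Longrightarrow> openin (quasi_topology X \<rho>) U"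
      "\<And>U. U \<in> \<U> \<Longrightarrow> emeasure R U < \<infinity>"
    and A: "A \<in> sets M" "emeasure L A = 0"
  shows "AE x in M. x \<in> A \<longrightarrow> (ball_quotient X \<rho> L M x \<longlongrightarrow> 0) (at_right 0)"
proof -
  obtain C where C: "0 < C" and engulf: "\<And>x r. x \<in> X \<Longrightarrow> 0 < r \<Longrightarrow>
       emeasure M (quasiball X \<rho> x (4 * A0 * r)) \<le> ennreal C * emeasure M (quasiball X \<rho> x r)"
    by (fact engulfing_constant)
  obtain A' B' where A': "A' \<in> quasi_borel X \<rho>" "A' \<subseteq> A"
    and B': "B' \<in> quasi_borel X \<rho>" "A \<subseteq> B'" "emeasure M (B' - A') = 0"
    using bmn[unfolded measurable_sets_borel_mod_null_def, rule_format, OF A(1)] by blast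
  \<comment> \<open>Outer regularity speaks of Borel sets; passing from \<open>A\<close> to \<open>A'\<close> costs only a null set.\<close>
  have A'M: "A' \<in> sets M" using A' borel_sets by blast
  have "B' - A' \<in> null_sets M" using B' A'M borel_sets by (auto simp: null_sets_def)
  then have AA': "AE x in M. x \<in> A \<longrightarrow> x \<in> A'"
    by (rule AE_I') (use B' in auto)
  define bad where "bad U n = {x \<in> A' \<inter> U. \<forall>d>0. \<exists>r. 0 < r \<and> r < d \<and>
     ennreal (inverse (Suc n)) * emeasure M (quasicball X \<rho> x r) \<le> emeasure L (quasicball X \<rho> x r)}"
    for U and n :: nat
  have null: "AE x in M. x \<notin> bad U n" if U: "U \<in> \<U>" for U n
  proof (rule AE_notin_of_small_cover)
    fix e :: real assume e: "0 < e"
    \<comment> \<open>The weak type inequality loses the factor \<open>Suc n * C\<close> and the domination of \<open>L\<close> by \<open>R\<close> the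
      factor \<open>c\<close>; the summand \<open>1\<close> covers the case \<open>c = 0\<close>.\<close>
    define d where "d = e / (Suc n * C * (c + 1))"
    have d: "0 < d" using e C c by (simp add: d_def)
    have "emeasure L A' = 0"
      using emeasure_mono[of A' A L] A A' sets_L by simp
    then obtain V where V: "openin (quasi_topology X \<rho>) V" "A' \<inter> U \<subseteq> V" "emeasure L V \<le> ennreal (c * d)"
      using open_superset_small[OF sets_L sets_R reg le c A'(1) _ cov(3)[OF U] cov(4)[OF U] d] by blast
    have VM: "V \<in> sets M" using V(1) by (rule open_sets)
    have balls: "\<exists>r. 0 < r \<and> r \<le> 1 \<and> quasicball X \<rho> x r \<subseteq> V \<and>
      ennreal (inverse (Suc n)) * emeasure M (quasicball X \<rho> x r) \<le> emeasure L (quasicball X \<rho> x r)"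
      if x: "x \<in> bad U n" for x
    proof -
      have "x \<in> V" using x V(2) by (auto simp: bad_def)
      then obtain s where s: "0 < s" "quasiball X \<rho> x s \<subseteq> V"
        using V(1) unfolding openin_quasi_topology by blast
      have "0 < min s 1" using s by simp
      with x obtain r where r: "0 < r" "r < min s 1"
        "ennreal (inverse (Suc n)) * emeasure M (quasicball X \<rho> x r) \<le> emeasure L (quasicball X \<rho> x r)"
        unfolding bad_def by blast
      moreover have "quasicball X \<rho> x r \<subseteq> quasiball X \<rho> x s"
        using r by (auto simp: in_ball in_cball)
      ultimately show ?thesis using s by (intro exI[of _ r]) auto
    qed
    have "bad U n \<subseteq> X" using openin_subset[OF cov(3)[OF U]] by (auto simp: bad_def)
    then obtain W where W: "W \<in> sets M" "bad U n \<subseteq> W"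
        "ennreal (inverse (Suc n)) * emeasure M W \<le> ennreal C * emeasure L V"
      using Vitali_weak_type[OF engulf sets_L VM _ balls, of "bad U n"] by blast
    have "emeasure M W = ennreal (Suc n) * (ennreal (inverse (Suc n)) * emeasure M W)"
      by (simp add: mult.assoc[symmetric] ennreal_mult[symmetric] del: of_nat_Suc)
    also have "\<dots> \<le> ennreal (Suc n) * (ennreal C * ennreal (c * d))"
      by (rule mult_left_mono[OF order_trans[OF W(3) mult_left_mono[OF V(3)]]]) auto
    also have "\<dots> = ennreal (Suc n * (C * (c * d)))"
      using C c d by (simp add: ennreal_mult del: of_nat_Suc)
    also have "\<dots> \<le> ennreal e"
    proof (rule ennreal_leI)
      have "Suc n * (C * (c * d)) = e * (c / (c + 1))"
        using C c by (simp add: d_def divide_simps del: of_nat_Suc)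
      also have "\<dots> \<le> e * 1" using e c by (intro mult_left_mono) auto
      finally show "Suc n * (C * (c * d)) \<le> e" by simp
    qed
    finally show "\<exists>W\<in>sets M. bad U n \<subseteq> W \<and> emeasure M W \<le> ennreal e"
      using W by blast
  qed
  have "AE x in M. \<forall>U\<in>\<U>. \<forall>n. x \<notin> bad U n"
    using cov(1) null by (simp add: AE_ball_countable AE_all_countable)
  with AA' AE_space show ?thesis
  proof eventually_elim
    case (elim x)
    show ?case
    proof
      assume "x \<in> A"
      with elim have x: "x \<in> A'" "x \<in> X" using space by auto
      then obtain U where U: "U \<in> \<U>" "x \<in> U" using cov by blast
      show "(ball_quotient X \<rho> L M x \<longlongrightarrow> 0) (at_right 0)"
      proof (rule order_tendstoI)
        fix e :: ennreal assume "0 < e"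
        then obtain y where y: "0 < y" "y < e" using dense by blast
        then obtain q :: real where q: "0 < q" "ennreal q < e"
          by (cases y) (auto simp: ennreal_less_zero_iff)
        obtain n :: nat where n: "inverse (Suc n) < q" using q reals_Archimedean by blast
        have "x \<notin> bad U n" using elim U by blast
        then obtain d where d: "0 < d" and small: "\<And>r. 0 < r \<Longrightarrow> r < d \<Longrightarrow>
          emeasure L (quasicball X \<rho> x r) < ennreal (inverse (Suc n)) * emeasure M (quasicball X \<rho> x r)"
          using x U unfolding bad_def by (auto simp: not_le)
        have "ball_quotient X \<rho> L M x r < e" if r: "0 < r" "r < d" for r
        proof -
          have "ball_quotient X \<rho> L M x r \<le>
             ennreal (inverse (Suc n)) * emeasure M (quasicball X \<rho> x r) / emeasure M (quasicball X \<rho> x r)"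
            unfolding ball_quotient_def
            by (intro divide_right_mono_ennreal less_imp_le small r)
          also have "\<dots> = ennreal (inverse (Suc n))"
            using cball_pos[OF x(2) r(1)] cball_finite[OF x(2) r(1)]
            by (intro ennreal_mult_divide_eq) auto
          also have "\<dots> \<le> ennreal q" using n by (intro ennreal_leI) simp
          also have "\<dots> < e" by (rule q)
          finally show ?thesis .
        qed
        then show "\<forall>\<^sub>F r in at_right 0. ball_quotient X \<rho> L M x r < e"
          unfolding eventually_at_right_field using d by blast
      qed simp
    qed
  qed
qed

section \<open>Differentiation of densities\<close>

lemma ball_quotient_density_subadd:
  assumes x: "x \<in> X" and r: "0 < r" and fgh: "\<And>y. y \<in> X \<Longrightarrow> f y \<le> g y + h y"
    and [measurable]: "f \<in> borel_measurable M" "g \<in> borel_measurable M" "h \<in> borel_measurable M"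
  shows "ball_quotient X \<rho> (density M f) M x r \<le>
    ball_quotient X \<rho> (density M g) M x r + ball_quotient X \<rho> (density M h) M x r"
proof -
  note [measurable] = cball_sets[OF x r]
  have "emeasure (density M f) (quasicball X \<rho> x r) \<le>
      (\<integral>\<^sup>+y. g y * indicator (quasicball X \<rho> x r) y + h y * indicator (quasicball X \<rho> x r) y \<partial>M)"
    using fgh space by (auto simp: emeasure_density split: split_indicator intro!: nn_integral_mono)
  also have "\<dots> = emeasure (density M g) (quasicball X \<rho> x r) + emeasure (density M h) (quasicball X \<rho> x r)"
    by (simp add: nn_integral_add emeasure_density)
  finally show ?thesis
    unfolding ball_quotient_def add_divide_distrib_ennreal[symmetric] by (rule divide_right_mono_ennreal)
qed

lemma ball_quotient_density_const:
  assumes x: "x \<in> X" and r: "0 < r"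
  shows "ball_quotient X \<rho> (density M (\<lambda>_. c)) M x r = c"
  using cball_sets[OF x r] cball_pos[OF x r] cball_finite[OF x r]
  by (simp add: ball_quotient_def emeasure_density nn_integral_cmult_indicator ennreal_mult_divide_eq)

text \<open>For a rational \<open>q\<close> the excess
  density \<open>f - q\<close>, truncated at zero, vanishes on the set where \<open>f \<le> q\<close>, so its quotients tend to
  zero almost everywhere there and the quotients of \<open>f \<le> q + (f - q)\<close> are eventually not much
  larger than \<open>q\<close>. Likewise the deficit \<open>q - f\<close> bounds them from below where \<open>f \<ge> q\<close>. The excess
  is dominated by \<open>f\<close> and the deficit by \<open>q\<close>, which is where regularity of both measures enters.
  Countably many \<open>q\<close> squeeze the quotients to \<open>f x\<close>.\<close>
lemma ball_quotient_tendsto_density: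
  assumes reg_M: "borel_regular X \<rho> M" and reg_N: "borel_regular X \<rho> (density M f)"
    and bmn: "measurable_sets_borel_mod_null X \<rho> M"
    and f[measurable]: "f \<in> borel_measurable M"
    and cov: "countable \<U>" "\<Union>\<U> = X" "\<And>U. U \<in> \<U> \<Longrightarrow> openin (quasi_topology X \<rho>) U"
      "\<And>U. U \<in> \<U> \<Longrightarrow> emeasure M U < \<infinity>" "\<And>U. U \<in> \<U> \<Longrightarrow> emeasure (density M f) U < \<infinity>"
  shows "AE x in M. (ball_quotient X \<rho> (density M f) M x \<longlongrightarrow> f x) (at_right 0)"
proof -
  let ?exc = "\<lambda>q::rat. density M (\<lambda>x. f x - ennreal (real_of_rat q))"
  let ?def = "\<lambda>q::rat. density M (\<lambda>x. ennreal (real_of_rat q) - f x)"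
  have exc: "AE x in M. x \<in> {x \<in> space M. f x \<le> ennreal (real_of_rat q)} \<longrightarrow>
      (ball_quotient X \<rho> (?exc q) M x \<longlongrightarrow> 0) (at_right 0)" for q
  proof (rule quotient_tendsto_0[OF _ _ reg_N _ _ bmn cov(1,2,3,5)])
    show "emeasure (?exc q) S \<le> ennreal 1 * emeasure (density M f) S" if "S \<in> sets M" for S
      using that by (auto simp: emeasure_density diff_le_self_ennreal intro!: nn_integral_mono mult_right_mono)
    show "emeasure (?exc q) {x \<in> space M. f x \<le> ennreal (real_of_rat q)} = 0"
      by (auto simp: emeasure_density nn_integral_0_iff_AE diff_eq_0_iff_ennreal
          intro!: AE_I2 le_less_trans[OF _ ennreal_less_top] split: split_indicator)
  qed auto
  have "AE x in M. x \<in> {x \<in> space M. ennreal (real_of_rat q) \<le> f x} \<longrightarrow>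
      (ball_quotient X \<rho> (?def q) M x \<longlongrightarrow> 0) (at_right 0)" for q
  proof (rule quotient_tendsto_0[OF _ _ reg_M _ _ bmn cov(1,2,3,4), of _ "max 0 (real_of_rat q)"])
    show "emeasure (?def q) S \<le> ennreal (max 0 (real_of_rat q)) * emeasure M S" if S: "S \<in> sets M" for S
    proof -
      have "emeasure (?def q) S = (\<integral>\<^sup>+x. (ennreal (real_of_rat q) - f x) * indicator S x \<partial>M)"
        using S by (simp add: emeasure_density)
      also have "\<dots> \<le> (\<integral>\<^sup>+x. ennreal (max 0 (real_of_rat q)) * indicator S x \<partial>M)"
        by (intro nn_integral_mono mult_right_mono order_trans[OF diff_le_self_ennreal] ennreal_leI) auto
      also have "\<dots> = ennreal (max 0 (real_of_rat q)) * emeasure M S"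
        using S by (simp add: nn_integral_cmult_indicator)
      finally show ?thesis .
    qed
    show "emeasure (?def q) {x \<in> space M. ennreal (real_of_rat q) \<le> f x} = 0"
      by (auto simp: emeasure_density nn_integral_0_iff_AE diff_eq_0_iff_ennreal intro!: AE_I2 split: split_indicator)
  qed auto
  then have "AE x in M. \<forall>q. ennreal (real_of_rat q) \<le> f x \<longrightarrow>
      (ball_quotient X \<rho> (?def q) M x \<longlongrightarrow> 0) (at_right 0)"
    unfolding AE_all_countable by (auto elim!: AE_mp intro!: AE_I2)
  moreover have "AE x in M. \<forall>q. f x \<le> ennreal (real_of_rat q) \<longrightarrow>
      (ball_quotient X \<rho> (?exc q) M x \<longlongrightarrow> 0) (at_right 0)"
    using exc unfolding AE_all_countable by (auto elim!: AE_mp intro!: AE_I2)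
  ultimately show ?thesis using AE_space
  proof eventually_elim
    case (elim x)
    then have x: "x \<in> X" by (simp add: space)
    have pos: "\<forall>\<^sub>F r::real in at_right 0. 0 < r" by (rule eventually_at_right_less)
    have le_diff: "a \<le> b + (a - b)" for a b :: ennreal
      by (metis add.commute diff_add_cancel_ennreal diff_add_self_ennreal le_add1 linear add_increasing2 order_refl zero_le)
    show ?case
    proof (rule order_tendstoI)
      fix a assume "f x < a"
      then obtain q where q: "f x < ennreal (real_of_rat q)" "ennreal (real_of_rat q) < a"
        using ennreal_rat_dense by blast
      have "0 < a - ennreal (real_of_rat q)"
        using q by (simp add: diff_gr0_ennreal)
      then have "\<forall>\<^sub>F r in at_right 0. ball_quotient X \<rho> (?exc q) M x r < a - ennreal (real_of_rat q)"
        using elim q by (intro order_tendstoD(2)[of _ 0]) auto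
      with pos show "\<forall>\<^sub>F r in at_right 0. ball_quotient X \<rho> (density M f) M x r < a"
      proof eventually_elim
        case (elim r)
        have "ball_quotient X \<rho> (density M f) M x r \<le> ennreal (real_of_rat q) + ball_quotient X \<rho> (?exc q) M x r"
          using ball_quotient_density_subadd[OF x elim(1), of f "\<lambda>_. ennreal (real_of_rat q)"
              "\<lambda>x. f x - ennreal (real_of_rat q)"] le_diff
          by (simp add: ball_quotient_density_const[OF x elim(1)])
        also have "\<dots> < a"
          using elim(2) q(2) by (simp add: less_diff_eq_ennreal add.commute)
        finally show ?case .
      qed
    next
      fix a assume a: "a < f x"
      then obtain q where q: "a < ennreal (real_of_rat q)" "ennreal (real_of_rat q) < f x"
        using ennreal_rat_dense by blast
      have "0 < ennreal (real_of_rat q) - a"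
        using q by (simp add: diff_gr0_ennreal)
      then have "\<forall>\<^sub>F r in at_right 0. ball_quotient X \<rho> (?def q) M x r < ennreal (real_of_rat q) - a"
        using elim q by (intro order_tendstoD(2)[of _ 0]) auto
      with pos show "\<forall>\<^sub>F r in at_right 0. a < ball_quotient X \<rho> (density M f) M x r"
      proof eventually_elim
        case (elim r)
        have "ennreal (real_of_rat q) \<le> ball_quotient X \<rho> (density M f) M x r + ball_quotient X \<rho> (?def q) M x r"
          using ball_quotient_density_subadd[OF x elim(1), of "\<lambda>_. ennreal (real_of_rat q)" f
              "\<lambda>x. ennreal (real_of_rat q) - f x"] le_diff
          by (simp add: ball_quotient_density_const[OF x elim(1)])
        moreover have "a + ball_quotient X \<rho> (?def q) M x r < ennreal (real_of_rat q)"
          using elim(2) a by (simp add: less_diff_eq_ennreal add.commute)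
        ultimately have "a + ball_quotient X \<rho> (?def q) M x r <
            ball_quotient X \<rho> (density M f) M x r + ball_quotient X \<rho> (?def q) M x r"
          by (rule less_le_trans[rotated])
        then show ?case
          by (meson add_right_mono not_le)
      qed
    qed
  qed
qed

text \<open>Outer regularity at a point of finite measure yields an open neighbourhood of finite
  measure, and such neighbourhoods cover the space countably. Finiteness of points is indispensable:
  a regular measure may be infinite on every nonempty set.\<close>
lemma locally_finite_cover:
  assumes reg: "borel_regular X \<rho> N" and sets_N: "sets N = sets M"
    and pts: "\<And>x. x \<in> X \<Longrightarrow> emeasure N {x} < \<infinity>"
  shows "\<exists>\<U>. countable \<U> \<and> \<Union>\<U> = X \<and>
    (\<forall>U\<in>\<U>. openin (quasi_topology X \<rho>) U \<and> emeasure M U < \<infinity> \<and> emeasure N U < \<infinity>)"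
proof (rule Lindelof)
  fix x assume x: "x \<in> X"
  obtain U where U: "openin (quasi_topology X \<rho>) U" "{x} \<subseteq> U" "emeasure N U < \<infinity>"
    using borel_regular_outer[OF reg singleton_borel[OF x] pts[OF x]] by blast
  obtain V where V: "openin (quasi_topology X \<rho>) V" "x \<in> V" "V \<subseteq> quasiball X \<rho> x 1"
    using open_inside_ball[OF x, of 1] by auto
  have "emeasure M (U \<inter> V) \<le> emeasure M (quasiball X \<rho> x 1)"
    using V x by (intro emeasure_mono ball_sets) auto
  moreover have "emeasure N (U \<inter> V) \<le> emeasure N U"
    using open_sets[OF U(1)] sets_N by (intro emeasure_mono) auto
  ultimately show "\<exists>U. openin (quasi_topology X \<rho>) U \<and> x \<in> U \<and> emeasure M U < \<infinity> \<and> emeasure N U < \<infinity>"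
    using U V ball_finite[OF x, of 1] by (intro exI[of _ "U \<inter> V"]) (auto intro: le_less_trans)
qed

text \<open>A measurable null set lies in a Borel null set, so testing Borel sets suffices.\<close>
lemma borel_null_imp_absolutely_continuous:
  assumes ac: "borel_absolutely_continuous X \<rho> N M" and sets_N: "sets N = sets M"
    and bmn: "measurable_sets_borel_mod_null X \<rho> M"
  shows "absolutely_continuous M N"
  unfolding absolutely_continuous_def
proof
  fix S assume S: "S \<in> null_sets M"
  then obtain A B where A: "A \<in> quasi_borel X \<rho>" "A \<subseteq> S" and B: "B \<in> quasi_borel X \<rho>" "S \<subseteq> B"
      "emeasure M (B - A) = 0"
    using bmn unfolding measurable_sets_borel_mod_null_def by (meson null_setsD2)
  have BM: "A \<in> sets M" "B \<in> sets M" using A B borel_sets by auto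
  have "emeasure M B \<le> emeasure M (B - A) + emeasure M S"
    using A B BM S by (intro order_trans[OF emeasure_mono emeasure_subadditive]) auto
  then have "emeasure M B = 0" using B S by auto
  then have "emeasure N B = 0" using ac B unfolding borel_absolutely_continuous_def by blast
  then have "B \<in> null_sets N" using BM sets_N by auto
  then show "S \<in> null_sets N"
    using B(2) S sets_N by (auto intro: null_sets_subset)
qed

end

section \<open>The Radon-Nikodym derivative as a limit over balls\<close>

lemma homogeneous_type_space_imp_doubling_quasimetric:
  assumes "homogeneous_type_space X \<rho> M"
  shows "\<exists>A0 A1. doubling_quasimetric X \<rho> M A0 A1"
proof -
  obtain A0 where A0: "1 \<le> A0" "\<And>x y z. x \<in> X \<Longrightarrow> y \<in> X \<Longrightarrow> z \<in> X \<Longrightarrow> \<rho> x z \<le> A0 * \<rho> x y + A0 * \<rho> y z"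
  proof -
    have "quasimetric_on X \<rho>" using assms by (simp add: homogeneous_type_space_def)
    then have "\<exists>A0\<ge>1. \<forall>x\<in>X. \<forall>y\<in>X. \<forall>z\<in>X. \<rho> x z \<le> A0 * \<rho> x y + A0 * \<rho> y z"
      unfolding quasimetric_on_def by (rule conjunct2)
    then show ?thesis using that by blast
  qed
  obtain A1 :: real where A1: "1 \<le> A1" and dbl: "\<And>x r. x \<in> X \<Longrightarrow> 0 < r \<Longrightarrow>
        0 < emeasure M (quasiball X \<rho> x (2 * r)) \<and>
        emeasure M (quasiball X \<rho> x (2 * r)) \<le> ennreal A1 * emeasure M (quasiball X \<rho> x r) \<and>
        ennreal A1 * emeasure M (quasiball X \<rho> x r) < \<infinity>"
  proof -
    have "doubling_measure X \<rho> M" using assms by (simp add: homogeneous_type_space_def)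
    then have "\<exists>A1::real. A1 \<ge> 1 \<and> (\<forall>x\<in>X. \<forall>r>0.
        0 < emeasure M (quasiball X \<rho> x (2 * r)) \<and>
        emeasure M (quasiball X \<rho> x (2 * r)) \<le> ennreal A1 * emeasure M (quasiball X \<rho> x r) \<and>
        ennreal A1 * emeasure M (quasiball X \<rho> x r) < \<infinity>)"
      unfolding doubling_measure_def by (rule conjunct2)
    then show ?thesis using that by blast
  qed
  have "doubling_quasimetric X \<rho> M A0 A1"
  proof
    fix x and r :: real assume xr: "x \<in> X" "0 < r"
    \<comment> \<open>Positivity is stated for doubled radii only.\<close>
    show "0 < emeasure M (quasiball X \<rho> x r)" using dbl[of x "r / 2"] xr by simp
    show "emeasure M (quasiball X \<rho> x r) < \<infinity>"
      using dbl[OF xr] A1 by (auto simp: ennreal_mult_less_top)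
    show "emeasure M (quasiball X \<rho> x (2 * r)) \<le> ennreal A1 * emeasure M (quasiball X \<rho> x r)"
      using dbl[OF xr] by blast
  qed (use assms A0 A1 in \<open>auto simp: homogeneous_type_space_def quasimetric_on_def doubling_measure_def\<close>)
  then show ?thesis by blast
qed

lemma borel_measurable_completion_AE_eq:
  assumes f: "f \<in> borel_measurable M" and eq: "AE x in M. f x = g x"
  shows "g \<in> borel_measurable (completion M)"
proof (rule measurableI)
  fix A :: "'b set" assume A: "A \<in> sets borel"
  have "f -` A \<inter> space M \<in> sets M" using f A by (rule measurable_sets)
  then have fA: "f -` A \<inter> space (completion M) \<in> sets (completion M)" by simp
  have "AE x in completion M. x \<in> f -` A \<inter> space (completion M) \<longleftrightarrow> x \<in> g -` A \<inter> space (completion M)"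
    using AE_completion[OF eq] by eventually_elim auto
  then show "g -` A \<inter> space (completion M) \<in> sets (completion M)"
    by (rule completion.in_sets_AE[OF _ fA]) auto
qed auto

theorem theorem4p12:
  fixes X :: "'a set" and \<rho> :: "'a \<Rightarrow> 'a \<Rightarrow> real" and M N :: "'a measure"
  assumes "homogeneous_type_space X \<rho> M"
    and "borel_regular X \<rho> M"
    and "measurable_sets_borel_mod_null X \<rho> M"
    and "sets N = sets M"
    and "borel_regular X \<rho> N"
    and "\<And>x. x \<in> X \<Longrightarrow> emeasure N {x} < \<infinity>"
    and "borel_absolutely_continuous X \<rho> N M"
  shows "(AE x in M. \<exists>l. (ball_quotient X \<rho> N M x \<longlongrightarrow> l) (at_right 0) \<and> l < \<infinity>) \<and>
    ball_derivative X \<rho> N M \<in> borel_measurable (completion M) \<and>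
    (\<forall>S\<in>sets M. emeasure N S = (\<integral>\<^sup>+x\<in>S. ball_derivative X \<rho> N M x \<partial>M))"
proof -
  obtain A0 A1 where "doubling_quasimetric X \<rho> M A0 A1"
    using homogeneous_type_space_imp_doubling_quasimetric[OF assms(1)] by blast
  then interpret doubling_quasimetric X \<rho> M A0 A1 .
  obtain \<U> where cov: "countable \<U>" "\<Union>\<U> = X"
    "\<And>U. U \<in> \<U> \<Longrightarrow> openin (quasi_topology X \<rho>) U \<and> emeasure M U < \<infinity> \<and> emeasure N U < \<infinity>"
    using locally_finite_cover[OF assms(5,4,6)] by blast
  obtain f where f[measurable]: "f \<in> borel_measurable M" and N: "N = density M f"
    using M.Radon_Nikodym[OF borel_null_imp_absolutely_continuous[OF assms(7,4,3)] assms(4)] by metis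
  have "sigma_finite_measure N"
  proof
    show "\<exists>A. countable A \<and> A \<subseteq> sets N \<and> \<Union>A = space N \<and> (\<forall>a\<in>A. emeasure N a \<noteq> \<infinity>)"
      using cov open_sets assms(4) sets_eq_imp_space_eq[OF assms(4)] space
      by (intro exI[of _ \<U>]) (auto simp: less_top)
  qed
  then have fin: "AE x in M. f x \<noteq> \<infinity>"
    using M.sigma_finite_iff_density_finite[OF f] N by simp
  have lim: "AE x in M. (ball_quotient X \<rho> N M x \<longlongrightarrow> f x) (at_right 0)"
    unfolding N
    by (rule ball_quotient_tendsto_density[OF assms(2) assms(5)[unfolded N] assms(3) f cov(1,2)])
       (use cov(3) N in auto)
  then have eq: "AE x in M. f x = ball_derivative X \<rho> N M x"
    by eventually_elim (simp add: ball_derivative_def tendsto_Lim)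
  have "AE x in M. \<exists>l. (ball_quotient X \<rho> N M x \<longlongrightarrow> l) (at_right 0) \<and> l < \<infinity>"
    using lim fin by eventually_elim (auto simp: less_top)
  moreover have "ball_derivative X \<rho> N M \<in> borel_measurable (completion M)"
    using f eq by (rule borel_measurable_completion_AE_eq)
  moreover have "emeasure N S = (\<integral>\<^sup>+x\<in>S. ball_derivative X \<rho> N M x \<partial>M)" if S: "S \<in> sets M" for S
  proof -
    have "emeasure N S = (\<integral>\<^sup>+x\<in>S. f x \<partial>M)" using S by (simp add: N emeasure_density)
    also have "\<dots> = (\<integral>\<^sup>+x\<in>S. ball_derivative X \<rho> N M x \<partial>M)"
      using eq by (intro nn_integral_cong_AE) (auto elim!: eventually_mono)
    finally show ?thesis .
  qed
  ultimately show ?thesis by blast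
qed

end
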